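(* Let $\boldsymbol{\delta}\in\mathbb{R}^L$ and $\mathbf{z}=\Phi_{b_0}\boldsymbol{\delta}\in\mathbb{R}^S$, where $\Phi_{b_0}\in\mathbb{R}^{S\times L}$ is the wavelet response operator at the fixed position $b_0$. Let $p(\cdot\mid b_0)$ be the conditional scale distribution and $H(\mathrm{scale}\mid b_0)$ the conditional scale entropy at $b_0$. Then: (i) $p(a_j\mid b_0)=z_j^2/\|\mathbf{z}\|^2$. (ii) $H(\mathrm{scale}\mid b_0)=\log S$ if and only if $|z_1|=\cdots=|z_S|$. (iii) $H(\mathrm{scale}\mid b_0)=0$ if and only if exactly one $z_j\neq 0$. (iv) $H(\mathrm{scale}\mid b_0)$ is invariant under $\boldsymbol{\delta}\mapsto c\boldsymbol{\delta}$ for any $c\neq 0$.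
   Context: Signal. $L$ is a positive integer (the number of layers of a transformer). A real signal $s(0),\dots,s(L)$ has updates $\delta_l=s(l+1)-s(l)$, $l=0,\dots,L-1$, collected in $\boldsymbol{\delta}=(\delta_0,\dots,\delta_{L-1})\in\mathbb{R}^L$. Let $\tilde s:\mathbb{R}\to\mathbb{R}$ be its piecewise-linear interpolant on $[0,L]$ with nodes $0,1,\dots,L$, extended by the constants $s(0)$ for $t<0$ and $s(L)$ for $t>L$. Wavelet transform. Let $\psi(t)=e^{-t^2/2}\cos(\omega_0 t)$ with $\omega_0=5$ (real Morlet wavelet). For $a>0$ and $b\in\mathbb{R}$, $$W_\psi\tilde s(a,b)=\frac{1}{\sqrt a}\int_{-\infty}^{\infty}\tilde s(t)\,\psi\!\left(\frac{t-b}{a}\right)dt .$$ The scalogram is $|W_\psi\tilde s(a,b)|^2$; it is evaluated at the $S=L+1$ integer scales $a_j=j$, $j=1,\dots,S$. Wavelet response operator. Fix a position $b_0$. Since $\tilde s$ is piecewise linear, $$W_\psi\tilde s(a_j,b_0)=\sum_{l=0}^{L-1}\delta_l\,\phi_l(a_j,b_0)+s(0)\sqrt{a_j}\,\hat\psi(0),\qquad \hat\psi(0)=\int_{-\infty}^{\infty}\psi(t)\,dt,$$ where $\phi_l(a,b)=\frac{1}{\sqrt a}\int_{-\infty}^{\infty}h_l(t)\,\psi\!\left(\frac{t-b}{a}\right)dt$ and $h_l(t)=\min(\max(t-l,0),1)$. The operator $\Phi_{b_0}\in\mathbb{R}^{S\times L}$ is the matrix with entries $\phi_l(a_j,b_0)$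 ($1\le j\le S$, $0\le l\le L-1$). It depends only on the wavelet and the positions of the nodes. Because $|\hat\psi(0)|\approx 9.3\times 10^{-6}$ is negligible, $|W_\psi\tilde s(a_j,b_0)|^2\approx z_j^2$ with $\mathbf{z}=\Phi_{b_0}\boldsymbol{\delta}$. Conditional scale distribution and entropy. Normalizing the energy across scales at the fixed position $b_0$ gives the conditional scale distribution, defined by $$p(a_j\mid b_0)=\frac{z_j^2}{\|\mathbf{z}\|^2},\qquad \mathbf{z}=\Phi_{b_0}\boldsymbol{\delta},$$ with $\|\cdot\|$ the Euclidean norm. The conditional scale entropy is its Shannon entropy $$H(\mathrm{scale}\mid b_0)=-\sum_{j=1}^{S}p(a_j\mid b_0)\log p(a_j\mid b_0),$$ with the convention $0\log 0:=0$. *)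

theory Defs
  imports "HOL-Analysis.Analysis" "Jordan_Normal_Form.Matrix"
begin

unbundle no vec_syntax

text \<open>
  Vectors of dimension \<open>n\<close> are \<open>real vec\<close> in \<open>carrier_vec n\<close>, whose entries are numbered from 0.
  Layers \<open>l = 0, \<dots>, L - 1\<close> need no shift; scales \<open>j = 1, \<dots>, S\<close> sit at entry \<open>j - 1\<close>.
\<close>

definition morlet :: "real \<Rightarrow> real" where
  "morlet t = exp (- (t\<^sup>2 / 2)) * cos (5 * t)"

definition wavelet_transform :: "(real \<Rightarrow> real) \<Rightarrow> real \<Rightarrow> real \<Rightarrow> real" where
  "wavelet_transform f a b = 1 / sqrt a * (\<integral>t. f t * morlet ((t - b) / a) \<partial>lborel)"

definition ramp :: "nat \<Rightarrow> real \<Rightarrow> real" where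
  "ramp l t = min (max (t - real l) 0) 1"

definition step_response :: "nat \<Rightarrow> real \<Rightarrow> real \<Rightarrow> real" where
  "step_response l a b = wavelet_transform (ramp l) a b"

definition num_scales :: "nat \<Rightarrow> nat" where
  "num_scales L = L + 1"

text \<open>Row \<open>i\<close> belongs to the scale \<open>a\<^sub>j = j\<close> with \<open>j = i + 1\<close>.\<close>

definition response_operator :: "nat \<Rightarrow> real \<Rightarrow> real mat" where
  "response_operator L b\<^sub>0 = mat (num_scales L) L (\<lambda>(i, l). step_response l (real (i + 1)) b\<^sub>0)"

definition euclidean_norm :: "real vec \<Rightarrow> real" where
  "euclidean_norm v = L2_set (\<lambda>i. v $ i) {..<dim_vec v}"

text \<open>
  Meaningful only when the response vector is nonzero; for a zero response, division by zero makes
  all the values 0.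
\<close>

definition scale_distribution :: "nat \<Rightarrow> real \<Rightarrow> real vec \<Rightarrow> nat \<Rightarrow> real" where
  "scale_distribution L b\<^sub>0 \<delta> j =
     (let z = response_operator L b\<^sub>0 *\<^sub>v \<delta> in (z $ (j - 1))\<^sup>2 / (euclidean_norm z)\<^sup>2)"

text \<open>The convention \<open>0 log 0 = 0\<close> needs no case distinction, because \<open>0 * ln 0 = 0\<close>.\<close>

definition scale_entropy :: "nat \<Rightarrow> real \<Rightarrow> real vec \<Rightarrow> real" where
  "scale_entropy L b\<^sub>0 \<delta> =
     - (\<Sum>j = 1..num_scales L. scale_distribution L b\<^sub>0 \<delta> j * ln (scale_distribution L b\<^sub>0 \<delta> j))"

end

theory Submission
  imports Defs
begin

text \<open>
  The summand of the relative entropy of a distribution \<open>p\<close> with respect to the uniform one on \<open>n\<close>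
  points, corrected by a term that sums to 0 so that each summand is nonnegative by itself.
\<close>

lemma uniform_entropy_gap:
  fixes p n :: real
  assumes "p \<ge> 0" "n > 0"
  shows "0 \<le> p * ln p + p * ln n + (1 / n - p)"
    and "p * ln p + p * ln n + (1 / n - p) = 0 \<longleftrightarrow> p = 1 / n"
proof -
  \<comment> \<open>With \<open>u = 1 / (p * n)\<close> the corrected summand is
    \<open>p * (u - 1 - ln u)\<close>. The bound \<open>ln u \<le> u - 1\<close> gives its sign, and
    equality there only at \<open>u = 1\<close> gives its zero.\<close>
  have *: "p * ln p + p * ln n + (1 / n - p) = p * (1 / (p * n) - 1 - ln (1 / (p * n)))" if "p > 0"
    using that \<open>n > 0\<close> by (simp add: ln_div ln_mult field_simps)
  have le: "ln (1 / (p * n)) \<le> 1 / (p * n) - 1" if "p > 0"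
    using that \<open>n > 0\<close> by (intro ln_le_minus_one) simp
  show "0 \<le> p * ln p + p * ln n + (1 / n - p)"
  proof (cases "p = 0")
    case False
    then have "p > 0" using \<open>p \<ge> 0\<close> by simp
    then show ?thesis using * le by simp
  qed (use \<open>n > 0\<close> in simp)
  show "p * ln p + p * ln n + (1 / n - p) = 0 \<longleftrightarrow> p = 1 / n"
  \<comment> \<open>At \<open>p = 0\<close> the corrected summand is \<open>1 / n > 0\<close>, so
    both sides of the equivalence fail.\<close>
  proof (cases "p = 0")
    case False
    then have p: "p > 0" using \<open>p \<ge> 0\<close> by simp
    have "1 / (p * n) = 1" if "p * ln p + p * ln n + (1 / n - p) = 0"
      using that * p \<open>n > 0\<close> by (intro ln_eq_minus_one) auto
    then show ?thesis using * p \<open>n > 0\<close> by (auto simp: ln_div eq_divide_eq)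
  qed (use \<open>n > 0\<close> in simp)
qed

text \<open>Since \<open>p\<close> has total mass 1, the corrections \<open>1 / n - p x\<close>
  cancel in the sum, and \<open>ln n\<close> minus the entropy is a sum of nonnegative gaps. It
  vanishes only if every gap does.\<close>

lemma entropy_eq_ln_card_iff:
  fixes p :: "'a \<Rightarrow> real"
  assumes "finite A" and nonneg: "\<And>x. x \<in> A \<Longrightarrow> p x \<ge> 0" and sum_one: "sum p A = 1"
  shows "- (\<Sum>x\<in>A. p x * ln (p x)) = ln (real (card A)) \<longleftrightarrow> (\<forall>x\<in>A. p x = 1 / real (card A))"
proof -
  define n where "n = real (card A)"
  \<comment> \<open>An empty sum would be 0, not 1; this makes \<open>n\<close> positive.\<close>
  have "A \<noteq> {}" using sum_one by auto
  then have n: "n > 0" using \<open>finite A\<close> by (simp add: n_def card_gt_0_iff)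
  let ?gap = "\<lambda>x. p x * ln (p x) + p x * ln n + (1 / n - p x)"
  have "sum ?gap A = (\<Sum>x\<in>A. p x * ln (p x)) + ln n"
    using sum_one n
    by (simp add: sum.distrib sum_subtractf flip: sum_distrib_right) (simp add: n_def)
  then have "- (\<Sum>x\<in>A. p x * ln (p x)) = ln n \<longleftrightarrow> sum ?gap A = 0"
    by linarith
  also have "\<dots> \<longleftrightarrow> (\<forall>x\<in>A. ?gap x = 0)"
    using \<open>finite A\<close> nonneg n by (intro sum_nonneg_eq_0_iff) (auto intro: uniform_entropy_gap(1))
  also have "\<dots> \<longleftrightarrow> (\<forall>x\<in>A. p x = 1 / n)"
    using nonneg n by (intro ball_cong refl uniform_entropy_gap(2))
  finally show ?thesis unfolding n_def .
qed

text \<open>Each \<open>p x\<close> lies between 0 and 1, so no term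
  \<open>- (p x * ln (p x))\<close> is negative and the entropy vanishes only termwise. This forces
  all values into {0, 1}, and total mass 1 leaves room for a single 1.\<close>

lemma entropy_eq_0_iff:
  fixes p :: "'a \<Rightarrow> real"
  assumes "finite A" and nonneg: "\<And>x. x \<in> A \<Longrightarrow> p x \<ge> 0" and sum_one: "sum p A = 1"
  shows "- (\<Sum>x\<in>A. p x * ln (p x)) = 0 \<longleftrightarrow> (\<exists>!x. x \<in> A \<and> p x \<noteq> 0)"
proof -
  have le_one: "p x \<le> 1" if "x \<in> A" for x
    using member_le_sum[OF that, of p] assms by simp
  have term_nonneg: "0 \<le> - (p x * ln (p x))" if "x \<in> A" for x
    using nonneg[OF that] le_one[OF that] by (cases "p x = 0") (auto simp: mult_le_0_iff)
  have "- (\<Sum>x\<in>A. p x * ln (p x)) = 0 \<longleftrightarrow> (\<Sum>x\<in>A. - (p x * ln (p x))) = 0"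
    by (simp add: sum_negf)
  also have "\<dots> \<longleftrightarrow> (\<forall>x\<in>A. - (p x * ln (p x)) = 0)"
    using \<open>finite A\<close> term_nonneg by (rule sum_nonneg_eq_0_iff)
  also have "\<dots> \<longleftrightarrow> (\<forall>x\<in>A. p x = 0 \<or> p x = 1)"
    using nonneg by (intro ball_cong refl) (fastforce simp: order_le_less)
  also have "\<dots> \<longleftrightarrow> (\<exists>!x. x \<in> A \<and> p x \<noteq> 0)"
  proof
    assume zero_one: "\<forall>x\<in>A. p x = 0 \<or> p x = 1"
    obtain a where a: "a \<in> A" "p a \<noteq> 0"
      using sum_one by (metis sum.neutral zero_neq_one)
    then have "p a = 1" using zero_one by blast
    \<comment> \<open>The point \<open>a\<close> already carries the whole mass, so the remaining
      nonnegative values sum to 0 and vanish one by one.\<close>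
    moreover have "sum p A = p a + sum p (A - {a})"
      using \<open>finite A\<close> a(1) by (rule sum.remove)
    ultimately have "sum p (A - {a}) = 0" using sum_one by simp
    then have "\<forall>x\<in>A - {a}. p x = 0"
      using \<open>finite A\<close> nonneg by (subst (asm) sum_nonneg_eq_0_iff) auto
    then show "\<exists>!x. x \<in> A \<and> p x \<noteq> 0" using a by blast
  next
    assume "\<exists>!x. x \<in> A \<and> p x \<noteq> 0"
    then obtain a where a: "a \<in> A" and others: "\<forall>x\<in>A - {a}. p x = 0" by blast
    have "sum p A = p a + sum p (A - {a})"
      using \<open>finite A\<close> a by (rule sum.remove)
    then have "p a = 1" using others sum_one by simp
    then show "\<forall>x\<in>A. p x = 0 \<or> p x = 1" using others by blast
  qed
  finally show ?thesis .
qed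

text \<open>Passes from entries numbered from 0 to scales numbered from 1, so that the squared norm
  becomes the normalizing sum of the scale distribution.\<close>

lemma euclidean_norm_power2: "(euclidean_norm v)\<^sup>2 = (\<Sum>j = 1..dim_vec v. (v $ (j - 1))\<^sup>2)"
proof -
  have "(euclidean_norm v)\<^sup>2 = (\<Sum>i<dim_vec v. (v $ i)\<^sup>2)"
    by (simp add: euclidean_norm_def L2_set_def sum_nonneg)
  also have "\<dots> = (\<Sum>j = 1..dim_vec v. (v $ (j - 1))\<^sup>2)"
    by (rule sum.reindex_bij_witness[of _ "\<lambda>j. j - 1" Suc]) auto
  finally show ?thesis .
qed

lemma euclidean_norm_eq_0_iff: "euclidean_norm v = 0 \<longleftrightarrow> v = 0\<^sub>v (dim_vec v)"
  by (auto simp: euclidean_norm_def L2_set_eq_0_iff vec_eq_iff)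

lemma euclidean_norm_smult: "euclidean_norm (c \<cdot>\<^sub>v v) = \<bar>c\<bar> * euclidean_norm v"
  by (simp add: euclidean_norm_def L2_set_def power_mult_distrib real_sqrt_mult
      flip: sum_distrib_left)

lemma response_operator_carrier: "response_operator L b\<^sub>0 \<in> carrier_mat (num_scales L) L"
  by (simp add: response_operator_def)

text \<open>The response is linear in the updates, so numerator and denominator both gain the factor
  \<open>c\<^sup>2\<close>, which cancels.\<close>

lemma scale_distribution_smult:
  assumes "\<delta> \<in> carrier_vec L" "c \<noteq> 0" "j \<in> {1..num_scales L}"
  shows "scale_distribution L b\<^sub>0 (c \<cdot>\<^sub>v \<delta>) j = scale_distribution L b\<^sub>0 \<delta> j"
proof -
  \<comment> \<open>An entry of a scaled vector is the scaled entry only for an index within the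
    dimension.\<close>
  have "j - 1 < dim_vec (response_operator L b\<^sub>0 *\<^sub>v \<delta>)"
    using assms(3) by (auto simp: response_operator_def)
  then show ?thesis
    using \<open>c \<noteq> 0\<close>
    by (simp add: scale_distribution_def Let_def euclidean_norm_smult power_mult_distrib
        mult_mat_vec[OF response_operator_carrier \<open>\<delta> \<in> carrier_vec L\<close>])
qed

theorem theorem1:
  fixes L S :: nat and b\<^sub>0 :: real and \<delta> z :: "real vec"
  assumes "L \<ge> 1" and "S = num_scales L"
    and "\<delta> \<in> carrier_vec L"
    and "z = response_operator L b\<^sub>0 *\<^sub>v \<delta>"
    and "z \<noteq> 0\<^sub>v S"
  shows "(\<forall>j\<in>{1..S}. scale_distribution L b\<^sub>0 \<delta> j = (z $ (j - 1))\<^sup>2 / (euclidean_norm z)\<^sup>2) \<and>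
         (scale_entropy L b\<^sub>0 \<delta> = ln (real S) \<longleftrightarrow>
             (\<forall>j\<in>{1..S}. \<forall>k\<in>{1..S}. \<bar>z $ (j - 1)\<bar> = \<bar>z $ (k - 1)\<bar>)) \<and>
         (scale_entropy L b\<^sub>0 \<delta> = 0 \<longleftrightarrow> (\<exists>!j. j \<in> {1..S} \<and> z $ (j - 1) \<noteq> 0)) \<and>
         (\<forall>c. c \<noteq> 0 \<longrightarrow> scale_entropy L b\<^sub>0 (c \<cdot>\<^sub>v \<delta>) = scale_entropy L b\<^sub>0 \<delta>)"
proof (intro conjI)
  have dim: "dim_vec z = S"
    using assms(2,4) by (simp add: response_operator_def)
  define N where "N = (euclidean_norm z)\<^sup>2"
  define p where "p = scale_distribution L b\<^sub>0 \<delta>"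
  \<comment> \<open>The nonzero response enters here: otherwise every quotient would take the
    default value 0 and \<open>p\<close> would not sum to 1.\<close>
  have N: "N > 0"
    using assms(5) by (simp add: N_def euclidean_norm_eq_0_iff dim)
  have p_eq: "p j = (z $ (j - 1))\<^sup>2 / N" for j
    by (simp add: p_def N_def scale_distribution_def Let_def assms(4))
  have p_nonneg: "p j \<ge> 0" for j
    using N by (simp add: p_eq)
  have p_sum: "sum p {1..S} = 1"
    using N by (simp add: p_eq N_def euclidean_norm_power2 dim flip: sum_divide_distrib)
  have H: "scale_entropy L b\<^sub>0 \<delta> = - (\<Sum>j\<in>{1..S}. p j * ln (p j))"
    by (simp add: scale_entropy_def p_def assms(2))
  have p_eq_iff: "p j = p k \<longleftrightarrow> \<bar>z $ (j - 1)\<bar> = \<bar>z $ (k - 1)\<bar>" for j k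
    using N by (simp add: p_eq power2_eq_iff abs_eq_iff)
  show "\<forall>j\<in>{1..S}. scale_distribution L b\<^sub>0 \<delta> j = (z $ (j - 1))\<^sup>2 / (euclidean_norm z)\<^sup>2"
    using p_eq by (simp add: p_def N_def)
  \<comment> \<open>The entropy criterion names the value \<open>1 / S\<close>, while the claim only
    compares scales with each other. Total mass 1 determines the common value.\<close>
  have uniform: "(\<forall>j\<in>{1..S}. p j = 1 / real S) \<longleftrightarrow> (\<forall>j\<in>{1..S}. \<forall>k\<in>{1..S}. p j = p k)"
  proof
    assume const: "\<forall>j\<in>{1..S}. \<forall>k\<in>{1..S}. p j = p k"
    show "\<forall>j\<in>{1..S}. p j = 1 / real S"
    proof
      fix j assume j: "j \<in> {1..S}"
      have "sum p {1..S} = (\<Sum>k\<in>{1..S}. p j)"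
        using const j by (intro sum.cong refl) blast
      then have "real S * p j = 1" using p_sum by simp
      then show "p j = 1 / real S" using j by (simp add: field_simps)
    qed
  next
    assume "\<forall>j\<in>{1..S}. p j = 1 / real S"
    then show "\<forall>j\<in>{1..S}. \<forall>k\<in>{1..S}. p j = p k" by metis
  qed
  show "scale_entropy L b\<^sub>0 \<delta> = ln (real S) \<longleftrightarrow>
      (\<forall>j\<in>{1..S}. \<forall>k\<in>{1..S}. \<bar>z $ (j - 1)\<bar> = \<bar>z $ (k - 1)\<bar>)"
    using entropy_eq_ln_card_iff[of "{1..S}" p] p_nonneg p_sum
    unfolding H p_eq_iff[symmetric] uniform[symmetric] by simp
  \<comment> \<open>As \<open>N > 0\<close>, the support of \<open>p\<close> is exactly the set of
    scales with nonzero response.\<close>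
  show "scale_entropy L b\<^sub>0 \<delta> = 0 \<longleftrightarrow> (\<exists>!j. j \<in> {1..S} \<and> z $ (j - 1) \<noteq> 0)"
    using entropy_eq_0_iff[of "{1..S}" p] p_nonneg p_sum N by (simp add: H p_eq)
  \<comment> \<open>The entropy depends on the updates only through the distribution at the scales
    \<open>1..S\<close>, which is unchanged.\<close>
  show "\<forall>c. c \<noteq> 0 \<longrightarrow> scale_entropy L b\<^sub>0 (c \<cdot>\<^sub>v \<delta>) = scale_entropy L b\<^sub>0 \<delta>"
    using scale_distribution_smult[OF assms(3)] by (simp add: scale_entropy_def)
qed

end
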